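(* Let $q\ge1$, and let $p(y|x_1,x_2)$, $x_1,x_2\in\{0,1\}$, be a channel with output alphabet $\{s_0,s_1,\dots,s_{q-1}\}$ and output $Y$. Let $\hat p(y|x_1,x_2)$ be a channel with output alphabet $\{s_0^1,s_0^2,s_1,\dots,s_{q-1}\}$ and output $\hat Y$, obtained by splitting $s_0$ into $s_0^1$ and $s_0^2$, i.e. $\hat p(s_0^1|x_1,x_2)+\hat p(s_0^2|x_1,x_2)=p(s_0|x_1,x_2)$ and $\hat p(s_j|x_1,x_2)=p(s_j|x_1,x_2)$ for all $j=1,\dots,q-1$ and all $x_1,x_2\in\{0,1\}$. Let $\mathscr R^{TIN},\mathscr R^{SC},r_s^{TIN},r_s^{SC}$ be the rate regions and sum rates for $Y$, and $\hat{\mathscr R}^{TIN},\hat{\mathscr R}^{SC},\hat r_s^{TIN},\hat r_s^{SC}$ those for $\hat Y$. Then $$\mathscr R^{TIN}\subseteq\hat{\mathscr R}^{TIN},\quad \mathscr R^{SC}\subseteq\hat{\mathscr R}^{SC},\quad r_s^{TIN}\le\hat r_s^{TIN},\quad r_s^{SC}\le\hat r_s^{SC}.$$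
   Context: In each channel the inputs $X_1,X_2$ are independent and uniform on $\{0,1\}$; mutual informations use logarithms to base 2. For a channel with output $Y$: TIN: $\mathscr R^{TIN}=\{(R_1,R_2):0\le R_1\le I(X_1;Y),\ 0\le R_2\le I(X_2;Y)\}$, $r_s^{TIN}=I(X_1;Y)+I(X_2;Y)$. SC: $\mathscr R^{SC}=\{(R_1,R_2):R_1,R_2\ge0,\ R_1\le I(X_1;Y|X_2),\ R_2\le I(X_2;Y|X_1),\ R_1+R_2\le I(X_1,X_2;Y)\}$, $r_s^{SC}=I(X_1,X_2;Y)$. The hatted quantities are defined by the same formulas with $\hat Y$ in place of $Y$. *)

theory Defs
  imports "HOL-Probability.Information"
begin

text \<open>
  A two-user binary-input multiple access channel with finite output alphabet \<open>A\<close>; the value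
  \<open>p y x1 x2\<close> is the transition probability \<open>p(y | x1, x2)\<close>. Values of \<open>p\<close> at inputs outside
  \<open>{0, 1}\<close> or at outputs outside \<open>A\<close> are irrelevant.
\<close>
definition mac :: "'y set \<Rightarrow> ('y \<Rightarrow> nat \<Rightarrow> nat \<Rightarrow> real) \<Rightarrow> bool" where
  "mac A p \<longleftrightarrow> finite A \<and>
     (\<forall>x1\<in>{0, 1}. \<forall>x2\<in>{0, 1}. (\<forall>y\<in>A. 0 \<le> p y x1 x2) \<and> (\<Sum>y\<in>A. p y x1 x2) = 1)"

text \<open>
  The canonical probability space carrying \<open>(X1, X2, Y)\<close>: the factors \<open>1/2\<close> are the laws of the
  independent uniform inputs, see \<open>mac_space_inputs\<close> and \<open>mac_space_output\<close> below.
\<close>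
definition mac_space :: "'y set \<Rightarrow> ('y \<Rightarrow> nat \<Rightarrow> nat \<Rightarrow> real) \<Rightarrow> (nat \<times> nat \<times> 'y) measure" where
  "mac_space A p = point_measure ({0, 1} \<times> {0, 1} \<times> A)
     (\<lambda>(x1, x2, y). ennreal (1/2 * (1/2) * p y x1 x2))"

definition X1 :: "nat \<times> nat \<times> 'y \<Rightarrow> nat" where "X1 = (\<lambda>(x1, x2, y). x1)"
definition X2 :: "nat \<times> nat \<times> 'y \<Rightarrow> nat" where "X2 = (\<lambda>(x1, x2, y). x2)"
definition Y :: "nat \<times> nat \<times> 'y \<Rightarrow> 'y" where "Y = (\<lambda>(x1, x2, y). y)"

lemma space_mac_space: "space (mac_space A p) = {0, 1} \<times> {0, 1} \<times> A"
  by (simp add: mac_space_def space_point_measure)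

lemma measure_mac_space:
  assumes "mac A p" "E \<subseteq> {0, 1} \<times> {0, 1} \<times> A"
  shows "measure (mac_space A p) E = (\<Sum>(x1, x2, y)\<in>E. 1/2 * (1/2) * p y x1 x2)"
proof -
  have "finite ({0, 1::nat} \<times> {0, 1::nat} \<times> A)"
    using assms(1) by (simp add: mac_def)
  with assms(2) have fin: "finite E" by (rule finite_subset)
  have p: "0 \<le> p y x1 x2" if "x1 \<in> {0, 1}" "x2 \<in> {0, 1}" "y \<in> A" for y x1 x2
    using assms(1) that by (auto simp: mac_def)
  have nn: "0 \<le> (case z of (x1, x2, y) \<Rightarrow> 1/2 * (1/2) * p y x1 x2)" if "z \<in> E" for z
  proof (cases z)
    case (fields x1 x2 y)
    with that assms(2) have "x1 \<in> {0, 1}" "x2 \<in> {0, 1}" "y \<in> A" by blast+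
    from p[OF this] fields show ?thesis by simp
  qed
  have "emeasure (mac_space A p) E =
      (\<Sum>z\<in>E. ennreal (case z of (x1, x2, y) \<Rightarrow> 1/2 * (1/2) * p y x1 x2))"
    unfolding mac_space_def using fin assms(2)
    by (subst emeasure_point_measure_finite2) (auto intro!: sum.cong)
  also have "\<dots> = ennreal (\<Sum>(x1, x2, y)\<in>E. 1/2 * (1/2) * p y x1 x2)"
    using nn by (rule sum_ennreal)
  finally show ?thesis
    using nn by (simp add: measure_def sum_nonneg)
qed

lemma mac_space_output:
  assumes "mac A p" "x1 \<in> {0, 1}" "x2 \<in> {0, 1}" "y \<in> A"
  shows "measure (mac_space A p) {\<omega> \<in> space (mac_space A p). X1 \<omega> = x1 \<and> X2 \<omega> = x2 \<and> Y \<omega> = y}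
    = 1/4 * p y x1 x2"
proof -
  have "{\<omega> \<in> space (mac_space A p). X1 \<omega> = x1 \<and> X2 \<omega> = x2 \<and> Y \<omega> = y} = {(x1, x2, y)}"
    using assms by (auto simp: space_mac_space X1_def X2_def Y_def)
  then show ?thesis
    using assms by (simp add: measure_mac_space)
qed

lemma mac_space_inputs:
  assumes "mac A p" "x1 \<in> {0, 1}" "x2 \<in> {0, 1}"
  shows "measure (mac_space A p) {\<omega> \<in> space (mac_space A p). X1 \<omega> = x1 \<and> X2 \<omega> = x2} = 1/2 * (1/2)"
proof -
  have "{\<omega> \<in> space (mac_space A p). X1 \<omega> = x1 \<and> X2 \<omega> = x2} = {x1} \<times> {x2} \<times> A"
    using assms by (auto simp: space_mac_space X1_def X2_def)
  moreover have "(\<Sum>y\<in>A. p y x1 x2) = 1"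
    using assms by (auto simp: mac_def)
  then have "(\<Sum>(x1, x2, y)\<in>{x1} \<times> {x2} \<times> A. 1/2 * (1/2) * p y x1 x2) = 1/2 * (1/2)"
    by (simp add: sum.cartesian_product[symmetric] sum_divide_distrib[symmetric])
  moreover have "{x1} \<times> {x2} \<times> A \<subseteq> {0, 1} \<times> {0, 1} \<times> A"
    using assms by auto
  ultimately show ?thesis
    using assms(1) by (simp only: measure_mac_space)
qed

lemma prob_space_mac_space:
  assumes "mac A p"
  shows "prob_space (mac_space A p)"
proof
  have nn: "0 \<le> p y x1 x2" if "x1 \<in> {0, 1}" "x2 \<in> {0, 1}" "y \<in> A" for y x1 x2
    using assms that by (auto simp: mac_def)
  have "emeasure (mac_space A p) (space (mac_space A p)) =
      (\<Sum>z\<in>{0, 1} \<times> {0, 1} \<times> A. ennreal (case z of (x1, x2, y) \<Rightarrow> 1/2 * (1/2) * p y x1 x2))"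
    unfolding space_mac_space unfolding mac_space_def using assms
    by (subst emeasure_point_measure_finite2) (auto simp: mac_def intro!: sum.cong)
  also have "\<dots> = ennreal (\<Sum>(x1, x2, y)\<in>{0, 1} \<times> {0, 1} \<times> A. 1/2 * (1/2) * p y x1 x2)"
    using nn by (intro sum_ennreal) auto
  also have "(\<Sum>(x1, x2, y)\<in>{0, 1} \<times> {0, 1} \<times> A. 1/2 * (1/2) * p y x1 x2) = 1"
    using assms
    by (simp add: mac_def sum.cartesian_product[symmetric] sum_divide_distrib[symmetric])
  finally show "emeasure (mac_space A p) (space (mac_space A p)) = 1" by simp
qed

text \<open>\<open>I(X1; Y)\<close>, \<open>I(X2; Y)\<close>, \<open>I(X1; Y | X2)\<close>, \<open>I(X2; Y | X1)\<close> and \<open>I(X1, X2; Y)\<close>, in bits:\<close>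

definition info_X1_Y :: "'y set \<Rightarrow> ('y \<Rightarrow> nat \<Rightarrow> nat \<Rightarrow> real) \<Rightarrow> real" where
  "info_X1_Y A p = prob_space.mutual_information (mac_space A p) 2
     (count_space {0, 1}) (count_space A) X1 Y"

definition info_X2_Y :: "'y set \<Rightarrow> ('y \<Rightarrow> nat \<Rightarrow> nat \<Rightarrow> real) \<Rightarrow> real" where
  "info_X2_Y A p = prob_space.mutual_information (mac_space A p) 2
     (count_space {0, 1}) (count_space A) X2 Y"

definition info_X1_Y_given_X2 :: "'y set \<Rightarrow> ('y \<Rightarrow> nat \<Rightarrow> nat \<Rightarrow> real) \<Rightarrow> real" where
  "info_X1_Y_given_X2 A p = prob_space.conditional_mutual_information (mac_space A p) 2
     (count_space {0, 1}) (count_space A) (count_space {0, 1}) X1 Y X2"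

definition info_X2_Y_given_X1 :: "'y set \<Rightarrow> ('y \<Rightarrow> nat \<Rightarrow> nat \<Rightarrow> real) \<Rightarrow> real" where
  "info_X2_Y_given_X1 A p = prob_space.conditional_mutual_information (mac_space A p) 2
     (count_space {0, 1}) (count_space A) (count_space {0, 1}) X2 Y X1"

definition info_X1X2_Y :: "'y set \<Rightarrow> ('y \<Rightarrow> nat \<Rightarrow> nat \<Rightarrow> real) \<Rightarrow> real" where
  "info_X1X2_Y A p = prob_space.mutual_information (mac_space A p) 2
     (count_space ({0, 1} \<times> {0, 1})) (count_space A) (\<lambda>\<omega>. (X1 \<omega>, X2 \<omega>)) Y"

definition region_TIN :: "'y set \<Rightarrow> ('y \<Rightarrow> nat \<Rightarrow> nat \<Rightarrow> real) \<Rightarrow> (real \<times> real) set" where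
  "region_TIN A p =
     {(R1, R2). 0 \<le> R1 \<and> R1 \<le> info_X1_Y A p \<and> 0 \<le> R2 \<and> R2 \<le> info_X2_Y A p}"

definition sum_rate_TIN :: "'y set \<Rightarrow> ('y \<Rightarrow> nat \<Rightarrow> nat \<Rightarrow> real) \<Rightarrow> real" where
  "sum_rate_TIN A p = info_X1_Y A p + info_X2_Y A p"

definition region_SC :: "'y set \<Rightarrow> ('y \<Rightarrow> nat \<Rightarrow> nat \<Rightarrow> real) \<Rightarrow> (real \<times> real) set" where
  "region_SC A p =
     {(R1, R2). 0 \<le> R1 \<and> 0 \<le> R2 \<and> R1 \<le> info_X1_Y_given_X2 A p \<and>
        R2 \<le> info_X2_Y_given_X1 A p \<and> R1 + R2 \<le> info_X1X2_Y A p}"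

definition sum_rate_SC :: "'y set \<Rightarrow> ('y \<Rightarrow> nat \<Rightarrow> nat \<Rightarrow> real) \<Rightarrow> real" where
  "sum_rate_SC A p = info_X1X2_Y A p"

end

theory Submission
  imports Defs
begin

text \<open>
  Each of the mutual informations is a sum over outputs \<open>y\<close> of terms \<open>u y * log 2 (u y / v y)\<close>
  in which \<open>u y\<close> and \<open>v y\<close> depend linearly on the transition probabilities \<open>p y\<close>. Splitting
  an output splits \<open>u\<close> and \<open>v\<close> additively, and by the log sum inequality this can only
  increase the sum.
\<close>

section \<open>The log sum inequality for two terms\<close>

definition kl :: "real \<Rightarrow> real \<Rightarrow> real" where
  "kl u v = u * log 2 (u / v)"

text \<open>\<open>kl\<close> is convex and positively homogeneous, and the left side, linear in
  \<open>(u, v)\<close>, is its tangent plane along the ray \<open>u = t * v\<close>. The bound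
  comes from \<open>ln x \<le> x - 1\<close>. Where \<open>v = 0 < u\<close> the relative entropy
  term would be infinite but \<open>kl\<close> is a real number; the third hypothesis excludes this
  case.\<close>

lemma kl_ge_tangent:
  assumes "0 \<le> u" "0 \<le> v" "v = 0 \<Longrightarrow> u = 0" "0 < t"
  shows "u * log 2 t + (u - v * t) / ln 2 \<le> kl u v"
proof (cases "u = 0")
  case True
  with assms show ?thesis by (simp add: kl_def divide_simps)
next
  case False
  with assms have pos: "0 < u" "0 < v" by force+
  \<comment> \<open>The quotient equals 1 exactly on the ray \<open>u = t * v\<close>, where the
    tangent plane touches \<open>kl\<close>.\<close>
  have "ln (v * t / u) \<le> v * t / u - 1"
    using pos assms(4) by (intro ln_le_minus_one) simp
  then have "u * ln (v * t / u) \<le> v * t - u"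
    using pos by (simp add: field_simps)
  then have "u * ln t + (u - v * t) \<le> u * ln (u / v)"
    using pos assms(4) by (simp add: ln_div ln_mult algebra_simps)
  then have "(u * ln t + (u - v * t)) / ln 2 \<le> u * ln (u / v) / ln 2"
    by (intro divide_right_mono) auto
  then show ?thesis
    by (simp add: kl_def log_def add_divide_distrib)
qed

lemma kl_add_le:
  assumes "0 \<le> u1" "0 \<le> v1" "v1 = 0 \<Longrightarrow> u1 = 0"
    and "0 \<le> u2" "0 \<le> v2" "v2 = 0 \<Longrightarrow> u2 = 0"
  shows "kl (u1 + u2) (v1 + v2) \<le> kl u1 v1 + kl u2 v2"
proof (cases "u1 + u2 = 0")
  case True
  then have "u1 = 0" "u2 = 0" using assms by auto
  then show ?thesis by (simp add: kl_def)
next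
  case False
  \<comment> \<open>The tangent plane is taken at the ratio of the sums: there it is exact for the
    sum and, being linear, splits into lower bounds for the two summands. The case
    \<open>u1 + u2 = 0\<close> would give \<open>t = 0\<close>, hence the case distinction.\<close>
  define t where "t = (u1 + u2) / (v1 + v2)"
  have "v1 + v2 \<noteq> 0" using False assms by force
  with False assms have v: "0 < v1 + v2" and t: "0 < t" by (auto simp: t_def)
  have eq: "(v1 + v2) * t = u1 + u2" using v by (simp add: t_def)
  have "kl (u1 + u2) (v1 + v2) = (u1 + u2) * log 2 t + (u1 + u2 - (v1 + v2) * t) / ln 2"
    unfolding eq by (simp add: kl_def t_def)
  also have "\<dots> = (u1 * log 2 t + (u1 - v1 * t) / ln 2) + (u2 * log 2 t + (u2 - v2 * t) / ln 2)"
    by (simp add: algebra_simps diff_divide_distrib add_divide_distrib)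
  also have "\<dots> \<le> kl u1 v1 + kl u2 v2"
    using assms t by (intro add_mono kl_ge_tangent) auto
  finally show ?thesis .
qed

section \<open>Joint laws of a function of the inputs and the output\<close>

abbreviation inputs :: "(nat \<times> nat) set" where
  "inputs \<equiv> {0, 1} \<times> {0, 1}"

text \<open>This is the probability of \<open>(X1, X2) \<in> E\<close> and \<open>Y = y\<close>. It
  is linear in the transition probabilities, so it is additive under splitting an output.\<close>

definition joint :: "('y \<Rightarrow> nat \<Rightarrow> nat \<Rightarrow> real) \<Rightarrow> (nat \<times> nat) set \<Rightarrow> 'y \<Rightarrow> real" where
  "joint p E y = (\<Sum>(x1, x2)\<in>E. 1/2 * (1/2) * p y x1 x2)"

definition fibre :: "(nat \<times> nat \<Rightarrow> 'c) \<Rightarrow> 'c \<Rightarrow> (nat \<times> nat) set" where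
  "fibre g c = {z \<in> inputs. g z = c}"

text \<open>The variables \<open>X1\<close>, \<open>X2\<close> and \<open>(X1, X2)\<close> are all
  of this form, so one formula for arbitrary \<open>g\<close> serves every information
  quantity.\<close>

definition input_fun :: "(nat \<times> nat \<Rightarrow> 'c) \<Rightarrow> nat \<times> nat \<times> 'y \<Rightarrow> 'c" where
  "input_fun g \<omega> = g (X1 \<omega>, X2 \<omega>)"

lemma fibre_subset: "fibre g c \<subseteq> inputs"
  by (auto simp: fibre_def)

lemma card_fibre_pos: "c \<in> g ` inputs \<Longrightarrow> 0 < card (fibre g c)"
  using finite_subset[OF fibre_subset] by (auto simp: card_gt_0_iff fibre_def)

lemma mac_nonempty: "mac A p \<Longrightarrow> A \<noteq> {}"
  by (auto simp: mac_def)

lemma joint_nonneg: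
  assumes "mac A p" "E \<subseteq> inputs" "y \<in> A"
  shows "0 \<le> joint p E y"
  unfolding joint_def using assms by (intro sum_nonneg) (auto simp: mac_def)

lemma joint_mono:
  assumes "mac A p" "E \<subseteq> F" "F \<subseteq> inputs" "y \<in> A"
  shows "joint p E y \<le> joint p F y"
  unfolding joint_def using assms
  by (intro sum_mono2) (auto simp: mac_def dest: finite_subset)

lemma sum_joint:
  assumes "mac A p" "E \<subseteq> inputs"
  shows "(\<Sum>y\<in>A. joint p E y) = card E / 4"
proof -
  have "(\<Sum>y\<in>A. joint p E y) = (\<Sum>(x1, x2)\<in>E. \<Sum>y\<in>A. 1/2 * (1/2) * p y x1 x2)"
    unfolding joint_def by (subst sum.swap) (simp add: case_prod_unfold)
  also have "\<dots> = (\<Sum>z\<in>E. 1 / 4)"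
    using assms
    by (intro sum.cong) (auto simp: mac_def sum_divide_distrib[symmetric])
  finally show ?thesis by simp
qed

text \<open>The common source of the laws of \<open>input_fun g\<close>, of \<open>Y\<close> and of
  the pair: take \<open>B\<close> a singleton or all of \<open>A\<close>.\<close>

lemma measure_input_output:
  assumes "mac A p" "E \<subseteq> inputs" "B \<subseteq> A"
  shows "measure (mac_space A p) ({\<omega>. (X1 \<omega>, X2 \<omega>) \<in> E \<and> Y \<omega> \<in> B} \<inter> space (mac_space A p))
    = (\<Sum>y\<in>B. joint p E y)"
proof -
  let ?f = "\<lambda>(x1, x2, y). 1/2 * (1/2) * p y x1 x2"
  \<comment> \<open>Regrouping the triples turns the event into the rectangle
    \<open>E \<times> B\<close>, over which the sums can be exchanged.\<close>
  let ?h = "\<lambda>((x1, x2), y). (x1, x2, y)"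
  have S: "{\<omega>. (X1 \<omega>, X2 \<omega>) \<in> E \<and> Y \<omega> \<in> B} \<inter> space (mac_space A p) = ?h ` (E \<times> B)"
    using assms(2,3)
    by (auto simp: space_mac_space X1_def X2_def Y_def image_iff Bex_def subset_iff)
  have "measure (mac_space A p) (?h ` (E \<times> B)) = sum ?f (?h ` (E \<times> B))"
    using assms by (intro measure_mac_space) auto
  also have "\<dots> = (\<Sum>z\<in>E \<times> B. ?f (?h z))"
    by (subst sum.reindex) (auto simp: inj_on_def)
  also have "\<dots> = (\<Sum>z\<in>E. \<Sum>y\<in>B. ?f (?h (z, y)))"
    by (simp add: sum.cartesian_product case_prod_unfold)
  also have "\<dots> = (\<Sum>y\<in>B. \<Sum>z\<in>E. ?f (?h (z, y)))"
    by (rule sum.swap)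
  also have "\<dots> = (\<Sum>y\<in>B. joint p E y)"
    by (simp add: joint_def case_prod_unfold)
  finally show ?thesis unfolding S .
qed

text \<open>The space is finite with all subsets measurable, so every function on it is simple; this
  is the form in which the library formulas for information take their variables.\<close>

lemma simple_distributed_mac_space:
  assumes "mac A p"
  shows "simple_distributed (mac_space A p) f
    (\<lambda>c. measure (mac_space A p) (f -` {c} \<inter> space (mac_space A p)))"
proof -
  interpret prob_space "mac_space A p" by (rule prob_space_mac_space[OF assms])
  have "finite (space (mac_space A p))"
    using assms by (simp add: space_mac_space mac_def)
  moreover have "sets (mac_space A p) = Pow (space (mac_space A p))"
    by (simp add: mac_space_def sets_point_measure space_point_measure)
  ultimately have "simple_function (mac_space A p) f"
    by (auto simp: simple_function_def)
  then show ?thesis by (rule simple_distributedI) auto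
qed

lemma measure_input_fun_Y:
  assumes "mac A p" "y \<in> A"
  shows "measure (mac_space A p) ((\<lambda>\<omega>. (input_fun g \<omega>, Y \<omega>)) -` {(c, y)} \<inter> space (mac_space A p))
    = joint p (fibre g c) y"
proof -
  have "(\<lambda>\<omega>. (input_fun g \<omega>, Y \<omega>)) -` {(c, y)} \<inter> space (mac_space A p)
      = {\<omega>. (X1 \<omega>, X2 \<omega>) \<in> fibre g c \<and> Y \<omega> \<in> {y}} \<inter> space (mac_space A p)"
    by (auto simp: input_fun_def fibre_def space_mac_space X1_def X2_def Y_def)
  then show ?thesis
    using measure_input_output[OF assms(1) fibre_subset, of "{y}"] assms(2) by simp
qed

lemma measure_input_fun:
  assumes "mac A p"
  shows "measure (mac_space A p) (input_fun g -` {c} \<inter> space (mac_space A p))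
    = card (fibre g c) / 4"
proof -
  have "input_fun g -` {c} \<inter> space (mac_space A p)
      = {\<omega>. (X1 \<omega>, X2 \<omega>) \<in> fibre g c \<and> Y \<omega> \<in> A} \<inter> space (mac_space A p)"
    by (auto simp: input_fun_def fibre_def space_mac_space X1_def X2_def Y_def)
  then show ?thesis
    by (simp only: measure_input_output[OF assms fibre_subset order_refl]
        sum_joint[OF assms fibre_subset])
qed

lemma measure_Y:
  assumes "mac A p" "y \<in> A"
  shows "measure (mac_space A p) (Y -` {y} \<inter> space (mac_space A p)) = joint p inputs y"
proof -
  have "Y -` {y} \<inter> space (mac_space A p)
      = {\<omega>. (X1 \<omega>, X2 \<omega>) \<in> inputs \<and> Y \<omega> \<in> {y}} \<inter> space (mac_space A p)"
    by (auto simp: space_mac_space X1_def X2_def Y_def)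
  then show ?thesis
    using measure_input_output[OF assms(1) order_refl, of "{y}"] assms(2) by simp
qed

section \<open>Information quantities as sums of \<open>kl\<close> terms\<close>

lemma space_mac_space_image:
  "space (mac_space A p) = (\<lambda>(z, y). (fst z, snd z, y)) ` (inputs \<times> A)"
  by (auto simp: space_mac_space image_iff Bex_def)

text \<open>The space contains every triple, including those of probability zero, so the range is a
  full product; the null points add \<open>kl 0 v = 0\<close>.\<close>

lemma image_input_fun_Y:
  "(\<lambda>\<omega>. (input_fun g \<omega>, Y \<omega>)) ` space (mac_space A p) = g ` inputs \<times> A"
  using image_paired_Times[of g "\<lambda>y. y" inputs A]
  unfolding space_mac_space_image
  by (simp add: image_image input_fun_def X1_def X2_def Y_def case_prod_unfold)

lemma image_Y: "Y ` space (mac_space A p) = A"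
  by (auto simp: space_mac_space Y_def image_iff Bex_def)

lemma image_input_fun:
  "A \<noteq> {} \<Longrightarrow> input_fun g ` space (mac_space A p) = g ` inputs"
  using arg_cong[OF image_input_fun_Y[of g A p], of "image fst"]
  by (simp add: image_image)

lemma mutual_information_input_fun:
  assumes "mac A p"
  shows "prob_space.mutual_information (mac_space A p) 2
      (count_space (g ` inputs)) (count_space A) (input_fun g) Y
    = (\<Sum>c\<in>g ` inputs. \<Sum>y\<in>A.
        kl (joint p (fibre g c) y) (card (fibre g c) / 4 * joint p inputs y))"
proof -
  interpret prob_space "mac_space A p" by (rule prob_space_mac_space[OF assms])
  interpret information_space "mac_space A p" 2 by unfold_locales simp
  note sd = simple_distributed_mac_space[OF assms]
  note A = mac_nonempty[OF assms]
  show ?thesis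
    using mutual_information_simple_distributed
      [OF sd[of "input_fun g"] sd[of Y] sd[of "\<lambda>\<omega>. (input_fun g \<omega>, Y \<omega>)"]] A
    by (simp add: image_input_fun image_Y image_input_fun_Y
        measure_input_fun[OF assms] measure_Y[OF assms] measure_input_fun_Y[OF assms]
        kl_def sum.cartesian_product[symmetric] cong: sum.cong)
qed

text \<open>The second argument of \<open>kl\<close> is \<open>P(c, d) * P(y, d) / P(d)\<close>. The
  factors 1/4 of the input law cancel and leave a ratio of cardinalities, which does not depend on
  the channel.\<close>

lemma conditional_mutual_information_input_fun:
  fixes A :: "'y set" and g :: "nat \<times> nat \<Rightarrow> 'c" and h :: "nat \<times> nat \<Rightarrow> 'd"
  assumes "mac A p"
  shows "prob_space.conditional_mutual_information (mac_space A p) 2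
      (count_space (g ` inputs)) (count_space A) (count_space (h ` inputs)) (input_fun g) Y (input_fun h)
    = (\<Sum>(c, d)\<in>(\<lambda>z. (g z, h z)) ` inputs. \<Sum>y\<in>A.
        kl (joint p (fibre (\<lambda>z. (g z, h z)) (c, d)) y)
          (real (card (fibre (\<lambda>z. (g z, h z)) (c, d))) / card (fibre h d) * joint p (fibre h d) y))"
proof -
  interpret prob_space "mac_space A p" by (rule prob_space_mac_space[OF assms])
  interpret information_space "mac_space A p" 2 by unfold_locales simp
  let ?M = "mac_space A p"
  let ?gh = "\<lambda>z. (g z, h z)"
  \<comment> \<open>The library formula sums over triples \<open>(c, y, d)\<close>;
    \<open>?k\<close> reorders them so that the sum over \<open>y\<close> becomes the inner
    one.\<close>
  let ?k = "\<lambda>((c, d), y). (c, y, d)"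
  define T where "T c y d = measure ?M ((\<lambda>\<omega>. (input_fun g \<omega>, Y \<omega>, input_fun h \<omega>)) -` {(c, y, d)} \<inter> space ?M)
      * log 2 (measure ?M ((\<lambda>\<omega>. (input_fun g \<omega>, Y \<omega>, input_fun h \<omega>)) -` {(c, y, d)} \<inter> space ?M)
        / (measure ?M ((\<lambda>\<omega>. (input_fun g \<omega>, input_fun h \<omega>)) -` {(c, d)} \<inter> space ?M)
          * (measure ?M ((\<lambda>\<omega>. (Y \<omega>, input_fun h \<omega>)) -` {(y, d)} \<inter> space ?M)
            / measure ?M (input_fun h -` {d} \<inter> space ?M))))" for c y d
  note sd = simple_distributed_mac_space[OF assms]
  note A = mac_nonempty[OF assms]
  have img: "(\<lambda>\<omega>. (input_fun g \<omega>, Y \<omega>, input_fun h \<omega>)) ` space ?M = ?k ` (?gh ` inputs \<times> A)"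
    unfolding image_input_fun_Y[of ?gh A p, symmetric] image_image
    by (simp add: input_fun_def)
  have T: "T c y d = kl (joint p (fibre ?gh (c, d)) y)
      (real (card (fibre ?gh (c, d))) / card (fibre h d) * joint p (fibre h d) y)" if "y \<in> A" for c y d
  proof -
    \<comment> \<open>All preimages are rewritten to those of an input function, alone or paired
      with \<open>Y\<close>, whose measures are known.\<close>
    have "(\<lambda>\<omega>. (input_fun g \<omega>, Y \<omega>, input_fun h \<omega>)) -` {(c, y, d)}
        = (\<lambda>\<omega>. (input_fun ?gh \<omega>, Y \<omega>)) -` {((c, d), y)}"
      by (auto simp: input_fun_def)
    moreover have "(\<lambda>\<omega>. (Y \<omega>, input_fun h \<omega>)) -` {(y, d)} = (\<lambda>\<omega>. (input_fun h \<omega>, Y \<omega>)) -` {(d, y)}"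
      by auto
    moreover have "(\<lambda>\<omega> :: nat \<times> nat \<times> 'y. (input_fun g \<omega>, input_fun h \<omega>)) -` {(c, d)} = input_fun ?gh -` {(c, d)}"
      by (auto simp: input_fun_def)
    ultimately show ?thesis
      using that by (simp add: T_def kl_def measure_input_fun_Y[OF assms] measure_input_fun[OF assms] mult.commute)
  qed
  have "prob_space.conditional_mutual_information ?M 2
      (count_space (g ` inputs)) (count_space A) (count_space (h ` inputs)) (input_fun g) Y (input_fun h)
    = (\<Sum>(c, y, d)\<in>?k ` (?gh ` inputs \<times> A). T c y d)"
    using conditional_mutual_information_eq[OF sd[of "input_fun h"]
        sd[of "\<lambda>\<omega>. (Y \<omega>, input_fun h \<omega>)"] sd[of "\<lambda>\<omega>. (input_fun g \<omega>, input_fun h \<omega>)"]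
        sd[of "\<lambda>\<omega>. (input_fun g \<omega>, Y \<omega>, input_fun h \<omega>)"]]
    unfolding img image_Y image_input_fun[OF A] T_def .
  also have "\<dots> = (\<Sum>((c, d), y)\<in>?gh ` inputs \<times> A. T c y d)"
    by (subst sum.reindex) (auto simp: inj_on_def case_prod_unfold)
  also have "\<dots> = (\<Sum>(c, d)\<in>?gh ` inputs. \<Sum>y\<in>A. T c y d)"
    by (simp add: sum.cartesian_product case_prod_unfold)
  also have "\<dots> = (\<Sum>(c, d)\<in>?gh ` inputs. \<Sum>y\<in>A. kl (joint p (fibre ?gh (c, d)) y)
      (real (card (fibre ?gh (c, d))) / card (fibre h d) * joint p (fibre h d) y))"
    by (intro sum.cong refl) (auto simp: T intro!: sum.cong)
  finally show ?thesis .
qed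

lemma input_fun_fst: "input_fun fst = X1"
  and input_fun_snd: "input_fun snd = X2"
  and input_fun_id: "input_fun (\<lambda>z. z) = (\<lambda>\<omega>. (X1 \<omega>, X2 \<omega>))"
  by (auto simp: input_fun_def)

section \<open>Monotonicity under splitting an output\<close>

locale output_split =
  fixes B :: "'y set" and s0 s01 s02 :: 'y and p p' :: "'y \<Rightarrow> nat \<Rightarrow> nat \<Rightarrow> real"
  assumes mac: "mac (insert s0 B) p"
    and mac': "mac ({s01, s02} \<union> B) p'"
    and notin: "s0 \<notin> B" "s01 \<notin> B" "s02 \<notin> B" "s01 \<noteq> s02"
    and split: "(x1, x2) \<in> inputs \<Longrightarrow> p' s01 x1 x2 + p' s02 x1 x2 = p s0 x1 x2"
    and same: "y \<in> B \<Longrightarrow> (x1, x2) \<in> inputs \<Longrightarrow> p' y x1 x2 = p y x1 x2"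
begin

text \<open>The terms over \<open>B\<close> agree, and the term at \<open>s0\<close> is bounded by
  those at \<open>s01\<close> and \<open>s02\<close> through \<open>kl_add_le\<close>. The factor
  \<open>c\<close> stands for a quantity of the input law, hence is the same for both
  channels.\<close>

lemma sum_kl_joint_le:
  assumes "E \<subseteq> F" "F \<subseteq> inputs" "0 < c"
  shows "(\<Sum>y\<in>insert s0 B. kl (joint p E y) (c * joint p F y))
    \<le> (\<Sum>y\<in>{s01, s02} \<union> B. kl (joint p' E y) (c * joint p' F y))"
proof -
  have B: "finite B" using mac by (simp add: mac_def)
  have add: "joint p D s0 = joint p' D s01 + joint p' D s02" if "D \<subseteq> inputs" for D
    unfolding joint_def sum.distrib[symmetric]
    by (rule sum.cong) (use that split in \<open>force simp: field_simps\<close>)+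
  have eq: "joint p D y = joint p' D y" if "D \<subseteq> inputs" "y \<in> B" for D y
    unfolding joint_def by (rule sum.cong) (use that same in force)+
  have E: "E \<subseteq> inputs" using assms by blast
  \<comment> \<open>Since \<open>E \<subseteq> F\<close>, the first joint probability is dominated
    by the second; this supplies the vanishing condition of \<open>kl_add_le\<close>.\<close>
  have zero: "joint p' E y = 0" if "y \<in> {s01, s02}" "c * joint p' F y = 0" for y
    using joint_nonneg[OF mac' E, of y] joint_mono[OF mac' assms(1,2), of y] that assms(3) by auto
  have nn: "0 \<le> joint p' E y" "0 \<le> c * joint p' F y" if "y \<in> {s01, s02}" for y
    using joint_nonneg[OF mac' E, of y] joint_nonneg[OF mac' assms(2), of y] that assms(3) by auto
  have "kl (joint p E s0) (c * joint p F s0)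
      \<le> kl (joint p' E s01) (c * joint p' F s01) + kl (joint p' E s02) (c * joint p' F s02)"
    unfolding add[OF E] add[OF assms(2)] distrib_left
    by (rule kl_add_le) (use nn zero in blast)+
  moreover have "(\<Sum>y\<in>B. kl (joint p E y) (c * joint p F y))
      = (\<Sum>y\<in>B. kl (joint p' E y) (c * joint p' F y))"
    by (rule sum.cong) (simp_all add: eq[OF E] eq[OF assms(2)])
  ultimately show ?thesis
    using B notin by simp
qed

text \<open>For each value of \<open>g\<close>, \<open>sum_kl_joint_le\<close> applies with
  \<open>E\<close> its fibre and \<open>F\<close> all of \<open>inputs\<close>.\<close>

lemma mutual_information_le:
  "prob_space.mutual_information (mac_space (insert s0 B) p) 2
      (count_space (g ` inputs)) (count_space (insert s0 B)) (input_fun g) Y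
    \<le> prob_space.mutual_information (mac_space ({s01, s02} \<union> B) p') 2
      (count_space (g ` inputs)) (count_space ({s01, s02} \<union> B)) (input_fun g) Y"
  unfolding mutual_information_input_fun[OF mac] mutual_information_input_fun[OF mac']
  by (intro sum_mono sum_kl_joint_le fibre_subset order_refl)
    (simp add: card_fibre_pos)

text \<open>Here \<open>E\<close> is a fibre of the pair of \<open>g\<close> and \<open>h\<close>,
  and \<open>F\<close> the fibre of \<open>h\<close> that contains it.\<close>

lemma conditional_mutual_information_le:
  "prob_space.conditional_mutual_information (mac_space (insert s0 B) p) 2
      (count_space (g ` inputs)) (count_space (insert s0 B)) (count_space (h ` inputs))
      (input_fun g) Y (input_fun h)
    \<le> prob_space.conditional_mutual_information (mac_space ({s01, s02} \<union> B) p') 2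
      (count_space (g ` inputs)) (count_space ({s01, s02} \<union> B)) (count_space (h ` inputs))
      (input_fun g) Y (input_fun h)"
  unfolding conditional_mutual_information_input_fun[OF mac]
    conditional_mutual_information_input_fun[OF mac']
proof (rule sum_mono, clarify)
  fix a b :: nat
  assume "a \<in> {0, 1}" "b \<in> {0, 1}"
  \<comment> \<open>Attained values have nonempty fibres, so the ratio of cardinalities is
    positive.\<close>
  then have "(g (a, b), h (a, b)) \<in> (\<lambda>z. (g z, h z)) ` inputs" "h (a, b) \<in> h ` inputs"
    by blast+
  note pos = this[THEN card_fibre_pos]
  have "fibre (\<lambda>z. (g z, h z)) (g (a, b), h (a, b)) \<subseteq> fibre h (h (a, b))"
    by (auto simp: fibre_def)
  then show "(\<Sum>y\<in>insert s0 B. kl (joint p (fibre (\<lambda>z. (g z, h z)) (g (a, b), h (a, b))) y)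
        (real (card (fibre (\<lambda>z. (g z, h z)) (g (a, b), h (a, b)))) / card (fibre h (h (a, b)))
          * joint p (fibre h (h (a, b))) y))
    \<le> (\<Sum>y\<in>{s01, s02} \<union> B. kl (joint p' (fibre (\<lambda>z. (g z, h z)) (g (a, b), h (a, b))) y)
        (real (card (fibre (\<lambda>z. (g z, h z)) (g (a, b), h (a, b)))) / card (fibre h (h (a, b)))
          * joint p' (fibre h (h (a, b))) y))"
    using pos by (intro sum_kl_joint_le fibre_subset) simp_all
qed

lemma info_le:
  shows "info_X1_Y (insert s0 B) p \<le> info_X1_Y ({s01, s02} \<union> B) p'"
    and "info_X2_Y (insert s0 B) p \<le> info_X2_Y ({s01, s02} \<union> B) p'"
    and "info_X1X2_Y (insert s0 B) p \<le> info_X1X2_Y ({s01, s02} \<union> B) p'"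
    and "info_X1_Y_given_X2 (insert s0 B) p \<le> info_X1_Y_given_X2 ({s01, s02} \<union> B) p'"
    and "info_X2_Y_given_X1 (insert s0 B) p \<le> info_X2_Y_given_X1 ({s01, s02} \<union> B) p'"
proof -
  \<comment> \<open>These images are the \<open>count_space\<close> carriers in the definitions of
    the information quantities.\<close>
  have img: "fst ` inputs = {0, 1}" "snd ` inputs = {0, 1}" "(\<lambda>z. z) ` inputs = inputs"
    by force+
  note fold = input_fun_fst input_fun_snd input_fun_id img
  show "info_X1_Y (insert s0 B) p \<le> info_X1_Y ({s01, s02} \<union> B) p'"
    unfolding info_X1_Y_def by (rule mutual_information_le[of fst, unfolded fold])
  show "info_X2_Y (insert s0 B) p \<le> info_X2_Y ({s01, s02} \<union> B) p'"
    unfolding info_X2_Y_def by (rule mutual_information_le[of snd, unfolded fold])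
  show "info_X1X2_Y (insert s0 B) p \<le> info_X1X2_Y ({s01, s02} \<union> B) p'"
    unfolding info_X1X2_Y_def by (rule mutual_information_le[of "\<lambda>z. z", unfolded fold])
  show "info_X1_Y_given_X2 (insert s0 B) p \<le> info_X1_Y_given_X2 ({s01, s02} \<union> B) p'"
    unfolding info_X1_Y_given_X2_def
    by (rule conditional_mutual_information_le[of fst snd, unfolded fold])
  show "info_X2_Y_given_X1 (insert s0 B) p \<le> info_X2_Y_given_X1 ({s01, s02} \<union> B) p'"
    unfolding info_X2_Y_given_X1_def
    by (rule conditional_mutual_information_le[of snd fst, unfolded fold])
qed

end

theorem lemma14:
  fixes q :: nat and s :: "nat \<Rightarrow> 'y" and s01 s02 :: 'y
    and p p' :: "'y \<Rightarrow> nat \<Rightarrow> nat \<Rightarrow> real"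
  defines "A \<equiv> s ` {0..<q}" and "A' \<equiv> {s01, s02} \<union> s ` {1..<q}"
  assumes "q \<ge> 1"
    and "inj_on s {0..<q}"
    and "s01 \<noteq> s02" and "s01 \<notin> s ` {1..<q}" and "s02 \<notin> s ` {1..<q}"
    and "mac A p"
    and "mac A' p'"
    and "\<And>x1 x2. x1 \<in> {0, 1} \<Longrightarrow> x2 \<in> {0, 1} \<Longrightarrow>
           p' s01 x1 x2 + p' s02 x1 x2 = p (s 0) x1 x2"
    and "\<And>j x1 x2. j \<in> {1..<q} \<Longrightarrow> x1 \<in> {0, 1} \<Longrightarrow> x2 \<in> {0, 1} \<Longrightarrow>
           p' (s j) x1 x2 = p (s j) x1 x2"
  shows "region_TIN A p \<subseteq> region_TIN A' p'
    \<and> region_SC A p \<subseteq> region_SC A' p'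
    \<and> sum_rate_TIN A p \<le> sum_rate_TIN A' p'
    \<and> sum_rate_SC A p \<le> sum_rate_SC A' p'"
proof -
  have "{0..<q} = insert 0 {1..<q}"
    using \<open>q \<ge> 1\<close> by auto
  then have A: "A = insert (s 0) (s ` {1..<q})"
    by (simp add: A_def)
  have "s 0 \<notin> s ` {1..<q}"
    using inj_onD[OF \<open>inj_on s {0..<q}\<close>, of 0] by force
  then interpret output_split "s ` {1..<q}" "s 0" s01 s02 p p'
    using assms A by unfold_locales auto
  note le = info_le[folded A A'_def]
  \<comment> \<open>The regions are cut out by upper bounds that are information quantities, so they
    grow with them.\<close>
  show ?thesis
    using le unfolding region_TIN_def region_SC_def sum_rate_TIN_def sum_rate_SC_def
    by fastforce
qed

end
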